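(* Let $m,s\in\mathbb{N}_0$ and let $\kappa\in\mathbb{R}$ with $|\kappa|>0$. Define $c_0=1$ and \[ c_j=\prod_{k=0}^{j-1}\left(-\frac{[2(s-k)-1]\,[2(m+s-k)-1]}{\kappa^2}\right),\qquad j>0 . \] Then \[ I_1(m+2s,m,\kappa,t)=\frac{1}{\kappa}\,t^{m}J_{m+1,\kappa}(t)\sum_{j=1}^{s}c_{s-j}t^{2j}+\frac{1}{\kappa^2}\,t^{m-1}J_{m,\kappa}(t)\sum_{j=1}^{s}c_{s-j}(2j-1)t^{2j}+c_s\,I_1(m,m,\kappa,t). \]
   Context: $\mathbb{N}_0=\{0,1,2,\dots\}$. $J_m$ is the Bessel function of the first kind of integer order $m$, and $J_{m,\kappa}(t):=J_m(\kappa t)$ for real $t$. $I_1(n,m,\kappa,t):=\int t^nJ_m(\kappa t)\,dt$ denotes the indefinite integral (an antiderivative in $t$ of $t^nJ_m(\kappa t)$); identities between indefinite integrals are understood up to an additive constant. Empty sums are $0$, and $t^{m-1}t^{2j}$ is read as $t^{m-1+2j}$ (so no negative power of $t$ occurs). *)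

theory Defs
  imports Complex_Main
begin

definition bessel_J :: "nat \<Rightarrow> real \<Rightarrow> real" where
  "bessel_J m x = (\<Sum>k. (-1) ^ k / (fact k * fact (m + k)) * (x / 2) ^ (2 * k + m))"

text \<open>
  An indefinite integral is represented by the set of all antiderivatives on the real line.
\<close>

definition indefinite_integral :: "(real \<Rightarrow> real) \<Rightarrow> (real \<Rightarrow> real) set" where
  "indefinite_integral f = {F. \<forall>t. (F has_real_derivative f t) (at t)}"

definition I1 :: "nat \<Rightarrow> nat \<Rightarrow> real \<Rightarrow> (real \<Rightarrow> real) set" where
  "I1 n m \<kappa> = indefinite_integral (\<lambda>t. t ^ n * bessel_J m (\<kappa> * t))"

text \<open>
  The coefficients depend on \<open>m\<close>, \<open>s\<close> and \<open>\<kappa>\<close> as well as on \<open>j\<close>. For \<open>j = 0\<close> the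
  empty product gives \<open>c\<^sub>0 = 1\<close>.
\<close>

definition c_coeff :: "nat \<Rightarrow> nat \<Rightarrow> real \<Rightarrow> nat \<Rightarrow> real" where
  "c_coeff m s \<kappa> j =
    (\<Prod>k<j. - ((2 * (real s - real k) - 1) * (2 * (real m + real s - real k) - 1) / \<kappa>\<^sup>2))"

end

theory Submission
  imports Defs
begin

text \<open>
  Put \<open>f\<^sub>j(t) = t\<^bsup>m+2j\<^esup> J\<^sub>m(\<kappa>t)\<close> and
  \<open>a\<^sub>j = (2j-1)(2(m+j)-1)/\<kappa>\<^sup>2\<close>. Integrating by parts twice, with the
  classical rules \<open>(x\<^bsup>m+1\<^esup> J\<^bsub>m+1\<^esub>)' = x\<^bsup>m+1\<^esup> J\<^sub>m\<close> and
  \<open>(x\<^bsup>-m\<^esup> J\<^sub>m)' = - x\<^bsup>-m\<^esup> J\<^bsub>m+1\<^esub>\<close>, lowers the power of \<open>t\<close> by two: the boundary term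
  \<open>A\<^sub>j(t) = t\<^bsup>m+2j\<^esup> J\<^bsub>m+1\<^esub>(\<kappa>t) / \<kappa> + (2j-1) t\<^bsup>m+2j-1\<^esup> J\<^sub>m(\<kappa>t) / \<kappa>\<^sup>2\<close>
  satisfies \<open>A\<^sub>j' = f\<^sub>j + a\<^sub>j f\<^bsub>j-1\<^esub>\<close> (\<open>boundary_term_deriv\<close>). The coefficients obey
  \<open>c\<^bsub>s-j+1\<^esub> = - a\<^sub>j c\<^bsub>s-j\<^esub>\<close> (\<open>c_coeff_step\<close>), so in \<open>\<Sum>\<^sub>j c\<^bsub>s-j\<^esub> A\<^sub>j'\<close> everything telescopes
  except \<open>f\<^sub>s - c\<^sub>s f\<^sub>0\<close>. Adding \<open>c\<^sub>s\<close> times an antiderivative of \<open>f\<^sub>0\<close> gives one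
  antiderivative of \<open>f\<^sub>s\<close>, and any two differ by a constant.

  The classical rules divide by \<open>x\<close> and say nothing at the origin. They are
  therefore used in the form of expressions for \<open>x J\<^sub>m'(x)\<close>, valid on the whole line;
  every power of \<open>t\<close> in \<open>A\<^sub>j\<close> is positive for \<open>j \<ge> 1\<close>, so its derivative involves
  \<open>J'\<close> only in such products. The expressions themselves come from writing
  \<open>J\<^sub>m(x) = (x/2)\<^sup>m E\<^sub>m((x/2)\<^sup>2)\<close> with an entire function \<open>E\<^sub>m\<close> for which
  \<open>E\<^sub>m' = - E\<^bsub>m+1\<^esub>\<close>.
\<close>

section \<open>The entire part of a Bessel function\<close>

definition bessel_clifford_coeff :: "nat \<Rightarrow> nat \<Rightarrow> real" where
  "bessel_clifford_coeff m k = (-1) ^ k / (fact k * fact (m + k))"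

text \<open>
  This is the Bessel-Clifford function of order \<open>m\<close> at \<open>-y\<close>; the sign
  is absorbed so that \<open>J\<^sub>m\<close> arises at \<open>y = (x/2)\<^sup>2\<close>.
\<close>

definition bessel_clifford :: "nat \<Rightarrow> real \<Rightarrow> real" where
  "bessel_clifford m y = (\<Sum>k. bessel_clifford_coeff m k * y ^ k)"

lemma summable_bessel_clifford:
  "summable (\<lambda>k. bessel_clifford_coeff m k * y ^ k)"
proof (rule summable_comparison_test')
  show "summable (\<lambda>k. inverse (fact k) * \<bar>y\<bar> ^ k)"
    by (rule summable_exp)
  fix k :: nat
  have "1 / (fact k * fact (m + k)) \<le> 1 / (fact k * (1 :: real))"
    by (intro divide_left_mono mult_left_mono) auto
  hence "1 / (fact k * fact (m + k)) * \<bar>y\<bar> ^ k \<le> inverse (fact k) * \<bar>y\<bar> ^ k"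
    by (intro mult_right_mono) (auto simp: inverse_eq_divide)
  thus "norm (bessel_clifford_coeff m k * y ^ k) \<le> inverse (fact k) * \<bar>y\<bar> ^ k"
    by (simp add: bessel_clifford_coeff_def abs_mult power_abs)
qed

lemma bessel_clifford_deriv:
  "(bessel_clifford m has_real_derivative - bessel_clifford (Suc m) y) (at y)"
proof -
  have "diffs (bessel_clifford_coeff m) k = - bessel_clifford_coeff (Suc m) k" for k
    by (simp add: diffs_def bessel_clifford_coeff_def field_simps del: of_nat_Suc)
  hence "(\<Sum>k. diffs (bessel_clifford_coeff m) k * y ^ k) = - bessel_clifford (Suc m) y"
    by (simp add: bessel_clifford_def suminf_minus[OF summable_bessel_clifford])
  moreover have "((\<lambda>y. \<Sum>k. bessel_clifford_coeff m k * y ^ k) has_real_derivative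
      (\<Sum>k. diffs (bessel_clifford_coeff m) k * y ^ k)) (at y)"
    by (rule termdiffs_strong_converges_everywhere) (rule summable_bessel_clifford)
  ultimately show ?thesis
    by (simp add: bessel_clifford_def[abs_def])
qed

text \<open>
  On coefficients this is \<open>m + k + 1 = (m + 1) + k\<close>: the factor \<open>k\<close> cancels one
  factor of \<open>fact k\<close> and shifts the index, which produces the factor \<open>y\<close>.
\<close>

lemma bessel_clifford_recurrence:
  "bessel_clifford m y =
     real (Suc m) * bessel_clifford (Suc m) y - y * bessel_clifford (Suc (Suc m)) y"
proof -
  define b where "b = bessel_clifford_coeff"
  have S: "(\<lambda>k. b n k * y ^ k) sums bessel_clifford n y" for n
    unfolding bessel_clifford_def b_def using summable_bessel_clifford by (rule summable_sums)
  have "(\<lambda>k. real (Suc k) * b (Suc m) (Suc k) * y ^ Suc k) sums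
      (- y * bessel_clifford (Suc (Suc m)) y)"
  proof -
    have "real (Suc k) * b (Suc m) (Suc k) = - b (Suc (Suc m)) k" for k
      by (simp add: b_def bessel_clifford_coeff_def field_simps del: of_nat_Suc)
    thus ?thesis
      using sums_mult[OF S[of "Suc (Suc m)"], of "- y"] by (simp add: mult_ac)
  qed
  hence shifted: "(\<lambda>k. real k * b (Suc m) k * y ^ k) sums
      (- y * bessel_clifford (Suc (Suc m)) y)"
    by (subst (asm) sums_Suc_iff) simp
  have "real (Suc m) * (b (Suc m) k * y ^ k) + real k * b (Suc m) k * y ^ k = b m k * y ^ k" for k
  proof -
    have "real (Suc (m + k)) * b (Suc m) k = b m k"
      by (simp add: b_def bessel_clifford_coeff_def field_simps del: of_nat_Suc)
    hence "b m k * y ^ k = real (Suc (m + k)) * b (Suc m) k * y ^ k"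
      by simp
    thus ?thesis
      by (simp add: algebra_simps)
  qed
  hence "(\<lambda>k. b m k * y ^ k) sums
      (real (Suc m) * bessel_clifford (Suc m) y + - y * bessel_clifford (Suc (Suc m)) y)"
    using sums_add[OF sums_mult[OF S[of "Suc m"], of "real (Suc m)"] shifted] by simp
  from sums_unique2[OF S[of m] this] show ?thesis
    by simp
qed

section \<open>Derivatives of Bessel functions\<close>

lemma bessel_J_eq_bessel_clifford: "bessel_J m x = (x / 2) ^ m * bessel_clifford m ((x / 2)\<^sup>2)"
proof -
  have "bessel_J m x = (\<Sum>k. (x / 2) ^ m * (bessel_clifford_coeff m k * ((x / 2)\<^sup>2) ^ k))"
    unfolding bessel_J_def bessel_clifford_coeff_def
    by (rule suminf_cong) (simp add: power_add power_mult)
  also have "\<dots> = (x / 2) ^ m * bessel_clifford m ((x / 2)\<^sup>2)"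
    unfolding bessel_clifford_def by (rule suminf_mult) (rule summable_bessel_clifford)
  finally show ?thesis .
qed

lemma bessel_J_recurrence:
  "2 * real (Suc m) * bessel_J (Suc m) x = x * (bessel_J m x + bessel_J (Suc (Suc m)) x)"
  unfolding bessel_J_eq_bessel_clifford bessel_clifford_recurrence[of m "(x / 2)\<^sup>2"]
  by (simp add: field_simps power2_eq_square)

text \<open>
  The product with \<open>x\<close> absorbs the \<open>x\<^bsup>m-1\<^esup>\<close> that arises from differentiating
  \<open>(x/2)\<^sup>m\<close>, which makes the identity uniform in \<open>m\<close> and true at \<open>0\<close>.
\<close>

lemma bessel_J_deriv:
  obtains D where "(bessel_J m has_real_derivative D) (at x)"
    and "x * D = real m * bessel_J m x - x * bessel_J (Suc m) x"
proof
  let ?D = "real m * (x / 2) ^ (m - 1) / 2 * bessel_clifford m ((x / 2)\<^sup>2)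
      - (x / 2) ^ m * (bessel_clifford (Suc m) ((x / 2)\<^sup>2) * (x / 2))"
  have square: "((\<lambda>x. (x / 2)\<^sup>2) has_real_derivative x / 2) (at x)"
    by (auto intro!: derivative_eq_intros)
  have power: "((\<lambda>x. (x / 2) ^ m) has_real_derivative real m * (x / 2) ^ (m - 1) / 2) (at x)"
    by (auto intro!: derivative_eq_intros)
  have "((\<lambda>x. (x / 2) ^ m * bessel_clifford m ((x / 2)\<^sup>2)) has_real_derivative ?D) (at x)"
    using DERIV_mult[OF power DERIV_chain2[OF bessel_clifford_deriv square]]
    by (simp add: algebra_simps)
  thus "(bessel_J m has_real_derivative ?D) (at x)"
    by (simp add: bessel_J_eq_bessel_clifford[abs_def])
  show "x * ?D = real m * bessel_J m x - x * bessel_J (Suc m) x"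
    unfolding bessel_J_eq_bessel_clifford by (cases m) (simp_all add: algebra_simps)
qed

text \<open>The same derivative with the recurrence used to go down in order.\<close>

lemma bessel_J_Suc_deriv:
  obtains D where "(bessel_J (Suc m) has_real_derivative D) (at x)"
    and "x * D = x * bessel_J m x - real (Suc m) * bessel_J (Suc m) x"
proof (rule bessel_J_deriv[of "Suc m" x])
  fix D
  assume D: "(bessel_J (Suc m) has_real_derivative D) (at x)"
    "x * D = real (Suc m) * bessel_J (Suc m) x - x * bessel_J (Suc (Suc m)) x"
  have "x * D = x * bessel_J m x - real (Suc m) * bessel_J (Suc m) x"
    using D(2) bessel_J_recurrence[of m x] by (simp only: distrib_left)
  with D(1) show thesis
    by (rule that)
qed

section \<open>Lowering the power by two\<close>

text \<open>
  The weight \<open>2j - 1\<close> on the second term is the one that cancels the two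
  contributions in \<open>J\<^bsub>m+1\<^esub>\<close>.
\<close>

lemma boundary_term_deriv:
  fixes \<kappa> t :: real
  assumes "\<kappa> \<noteq> 0" "j \<ge> 1"
  shows "((\<lambda>t. 1 / \<kappa> * (t ^ (m + 2 * j) * bessel_J (Suc m) (\<kappa> * t))
        + (2 * real j - 1) / \<kappa>\<^sup>2 * (t ^ (m + 2 * j - 1) * bessel_J m (\<kappa> * t)))
      has_real_derivative
        t ^ (m + 2 * j) * bessel_J m (\<kappa> * t)
        + (2 * real j - 1) * (2 * (real m + real j) - 1) / \<kappa>\<^sup>2
          * (t ^ (m + 2 * (j - 1)) * bessel_J m (\<kappa> * t))) (at t)"
proof -
  obtain i where j: "j = Suc i"
    using assms(2) by (cases j) auto
  let ?x = "\<kappa> * t" and ?p = "t ^ (m + 2 * i)"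
  let ?J = "bessel_J m (\<kappa> * t)" and ?K = "bessel_J (Suc m) (\<kappa> * t)"
  obtain D where D: "(bessel_J m has_real_derivative D) (at ?x)"
      "?x * D = real m * ?J - ?x * ?K"
    by (rule bessel_J_deriv)
  obtain D' where D': "(bessel_J (Suc m) has_real_derivative D') (at ?x)"
      "?x * D' = ?x * ?J - real (Suc m) * ?K"
    by (rule bessel_J_Suc_deriv)
  have first: "((\<lambda>t. t ^ (m + 2 * i + 2) * bessel_J (Suc m) (\<kappa> * t)) has_real_derivative
      ?p * ((2 * real i + 1) * (t * ?K) + \<kappa> * t\<^sup>2 * ?J)) (at t)"
  proof -
    have "((\<lambda>t. t ^ (m + 2 * i + 2) * bessel_J (Suc m) (\<kappa> * t)) has_real_derivative
        real (m + 2 * i + 2) * t ^ (m + 2 * i + 1) * ?K + t ^ (m + 2 * i + 2) * (D' * \<kappa>)) (at t)"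
      by (rule derivative_eq_intros refl
          DERIV_chain2[where g = "\<lambda>t. \<kappa> * t", OF D'(1)])+ simp
    also have "real (m + 2 * i + 2) * t ^ (m + 2 * i + 1) * ?K + t ^ (m + 2 * i + 2) * (D' * \<kappa>)
        = ?p * t * (real (m + 2 * i + 2) * ?K + ?x * D')"
      by (simp add: algebra_simps)
    also have "\<dots> = ?p * ((2 * real i + 1) * (t * ?K) + \<kappa> * t\<^sup>2 * ?J)"
      unfolding D'(2) by (simp add: algebra_simps power2_eq_square)
    finally show ?thesis .
  qed
  have second: "((\<lambda>t. t ^ (m + 2 * i + 1) * bessel_J m (\<kappa> * t)) has_real_derivative
      ?p * ((2 * real m + 2 * real i + 1) * ?J - \<kappa> * (t * ?K))) (at t)"
  proof -
    have "((\<lambda>t. t ^ (m + 2 * i + 1) * bessel_J m (\<kappa> * t)) has_real_derivative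
        real (m + 2 * i + 1) * ?p * ?J + t ^ (m + 2 * i + 1) * (D * \<kappa>)) (at t)"
      by (rule derivative_eq_intros refl
          DERIV_chain2[where g = "\<lambda>t. \<kappa> * t", OF D(1)])+ simp
    also have "real (m + 2 * i + 1) * ?p * ?J + t ^ (m + 2 * i + 1) * (D * \<kappa>)
        = ?p * (real (m + 2 * i + 1) * ?J + ?x * D)"
      by (simp add: algebra_simps)
    also have "\<dots> = ?p * ((2 * real m + 2 * real i + 1) * ?J - \<kappa> * (t * ?K))"
      unfolding D(2) by (simp add: algebra_simps)
    finally show ?thesis .
  qed
  have "((\<lambda>t. 1 / \<kappa> * (t ^ (m + 2 * i + 2) * bessel_J (Suc m) (\<kappa> * t))
        + (2 * real j - 1) / \<kappa>\<^sup>2 * (t ^ (m + 2 * i + 1) * bessel_J m (\<kappa> * t)))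
      has_real_derivative
        1 / \<kappa> * (?p * ((2 * real i + 1) * (t * ?K) + \<kappa> * t\<^sup>2 * ?J))
        + (2 * real j - 1) / \<kappa>\<^sup>2
          * (?p * ((2 * real m + 2 * real i + 1) * ?J - \<kappa> * (t * ?K)))) (at t)"
    by (intro DERIV_add DERIV_cmult first second)
  also have "1 / \<kappa> * (?p * ((2 * real i + 1) * (t * ?K) + \<kappa> * t\<^sup>2 * ?J))
        + (2 * real j - 1) / \<kappa>\<^sup>2
          * (?p * ((2 * real m + 2 * real i + 1) * ?J - \<kappa> * (t * ?K)))
      = t ^ (m + 2 * j) * ?J
        + (2 * real j - 1) * (2 * (real m + real j) - 1) / \<kappa>\<^sup>2 * (?p * ?J)"
    using assms(1) by (simp add: j field_simps power2_eq_square)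
  finally show ?thesis
    by (simp add: j)
qed

lemma c_coeff_0: "c_coeff m s \<kappa> 0 = 1"
  by (simp add: c_coeff_def)

lemma c_coeff_step:
  assumes "1 \<le> j" "j \<le> s"
  shows "c_coeff m s \<kappa> (s - (j - 1)) =
    - (c_coeff m s \<kappa> (s - j) * ((2 * real j - 1) * (2 * (real m + real j) - 1) / \<kappa>\<^sup>2))"
proof -
  have index: "s - (j - 1) = Suc (s - j)" and "real s - real (s - j) = real j"
    and "real m + real s - real (s - j) = real m + real j"
    using assms by (auto simp: of_nat_diff)
  thus ?thesis
    by (simp add: c_coeff_def)
qed

section \<open>The reduction formula\<close>

theorem proposition2p7:
  fixes m s :: nat and \<kappa> :: real and F G :: "real \<Rightarrow> real"
  assumes "\<bar>\<kappa>\<bar> > 0"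
    and "G \<in> I1 m m \<kappa>"
  shows "F \<in> I1 (m + 2 * s) m \<kappa> \<longleftrightarrow>
    (\<exists>C. \<forall>t. F t =
        1 / \<kappa> * t ^ m * bessel_J (m + 1) (\<kappa> * t)
            * (\<Sum>j = 1..s. c_coeff m s \<kappa> (s - j) * t ^ (2 * j))
      + 1 / \<kappa>\<^sup>2 * bessel_J m (\<kappa> * t)
            * (\<Sum>j = 1..s. c_coeff m s \<kappa> (s - j) * (2 * real j - 1) * t ^ (m + 2 * j - 1))
      + c_coeff m s \<kappa> s * G t + C)"
proof -
  let ?c = "c_coeff m s \<kappa>"
  define f where "f j t = t ^ (m + 2 * j) * bessel_J m (\<kappa> * t)" for j and t :: real
  define a where "a j = (2 * real j - 1) * (2 * (real m + real j) - 1) / \<kappa>\<^sup>2" for j :: nat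
  define A where "A j t = 1 / \<kappa> * (t ^ (m + 2 * j) * bessel_J (Suc m) (\<kappa> * t))
      + (2 * real j - 1) / \<kappa>\<^sup>2 * (t ^ (m + 2 * j - 1) * bessel_J m (\<kappa> * t))" for j and t :: real
  define R where "R t = (\<Sum>j = 1..s. ?c (s - j) * A j t) + ?c s * G t" for t
  have A': "(A j has_real_derivative f j t + a j * f (j - 1) t) (at t)" if "j \<ge> 1" for j t
    unfolding A_def[abs_def] f_def a_def using assms(1) that
    by (intro boundary_term_deriv) auto
  have G': "(G has_real_derivative f 0 t) (at t)" for t
    using assms(2) by (simp add: I1_def indefinite_integral_def f_def)
  have R': "(R has_real_derivative f s t) (at t)" for t
  proof -
    have "(R has_real_derivative
        (\<Sum>j = 1..s. ?c (s - j) * (f j t + a j * f (j - 1) t)) + ?c s * f 0 t) (at t)"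
      unfolding R_def[abs_def]
      by (intro DERIV_add DERIV_sum DERIV_cmult A' G') auto
    also have "(\<Sum>j = 1..s. ?c (s - j) * (f j t + a j * f (j - 1) t))
        = (\<Sum>j = 1..s. ?c (s - j) * f j t - ?c (s - (j - 1)) * f (j - 1) t)"
      by (intro sum.cong refl) (simp only: atLeastAtMost_iff c_coeff_step a_def, simp add: algebra_simps)
    also have "\<dots> = f s t - ?c s * f 0 t"
      using sum_telescope''[of 0 s "\<lambda>j. ?c (s - j) * f j t"]
      by (simp add: c_coeff_0 atLeastSucAtMost_greaterThanAtMost)
    finally show ?thesis
      by simp
  qed
  have R_eq: "R t =
        1 / \<kappa> * t ^ m * bessel_J (m + 1) (\<kappa> * t) * (\<Sum>j = 1..s. ?c (s - j) * t ^ (2 * j))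
      + 1 / \<kappa>\<^sup>2 * bessel_J m (\<kappa> * t)
            * (\<Sum>j = 1..s. ?c (s - j) * (2 * real j - 1) * t ^ (m + 2 * j - 1))
      + ?c s * G t" for t
    unfolding R_def A_def sum_distrib_left sum.distrib[symmetric]
    by (intro arg_cong2[where f = "(+)"] sum.cong refl)
      (use assms(1) in \<open>simp add: power_add field_simps\<close>)
  have "F \<in> I1 (m + 2 * s) m \<kappa> \<longleftrightarrow> (\<forall>t. (F has_real_derivative f s t) (at t))"
    by (simp add: I1_def indefinite_integral_def f_def)
  also have "\<dots> \<longleftrightarrow> (\<exists>C. \<forall>t. F t = R t + C)"
  proof
    assume "\<forall>t. (F has_real_derivative f s t) (at t)"
    hence "\<forall>t. ((\<lambda>t. F t - R t) has_real_derivative 0) (at t)"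
      using DERIV_diff[OF _ R'] by fastforce
    hence "F t - R t = F 0 - R 0" for t
      by (rule DERIV_isconst_all)
    hence "\<forall>t. F t = R t + (F 0 - R 0)"
      by (simp add: algebra_simps)
    thus "\<exists>C. \<forall>t. F t = R t + C" ..
  next
    assume "\<exists>C. \<forall>t. F t = R t + C"
    then obtain C where "F = (\<lambda>t. R t + C)"
      by blast
    thus "\<forall>t. (F has_real_derivative f s t) (at t)"
      using DERIV_add[OF R' DERIV_const] by simp
  qed
  finally show ?thesis
    unfolding R_eq .
qed

end
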